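(* Let $A_\pi=(a_{ij})$ be a real $n\times n$ matrix with $a_{i\pi(i)}>0$ for $1\le i\le n$ and all other entries zero, where $\pi$ is a permutation of $\{1,\dots,n\}$. If $\pi$ has the following decomposition into disjoint cycles $$\pi=(i_{11},i_{12},\dots,i_{1k_1})(i_{21},i_{22},\dots,i_{2k_2})\cdots(i_{q1},i_{q2},\dots,i_{qk_q}),\quad 1\le q\le n,\ 1\le k_j\le n,$$ then: (1) If $a_{i_{j1}i_{j2}}a_{i_{j2}i_{j3}}\cdots a_{i_{jk_j}i_{j1}}\ne 1$ for all $j=1,\dots,q$, then the fixed point $(0,0,\dots,0)$ of $A_\pi$ is unique. (2) If there are $j_1,j_2,\dots,j_p$, with some $p\in\{1,\dots,q\}$, such that $a_{i_{j_s1}i_{j_s2}}\cdots a_{i_{j_sk_{j_s}}i_{j_s1}}=1$ for $s=1,\dots,p$, then there are infinitely many fixed points, with $p$ free coordinates if $p<q$ and with $q-1$ free coordinates if $p=q$.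
   Context: $\mathbf R_{\max}=\mathbf R\cup\{-\infty\}$ and $\mathcal I_n=\{(x_1,\dots,x_n)\in\mathbf R_{\max}^n:\max_{1\le i\le n}x_i=0\}$. The matrix acts by ordinary matrix-vector multiplication, so $(A_\pi(x))_i=a_{i\pi(i)}x_{\pi(i)}$, and it maps $\mathcal I_n$ to itself. Fixed points of $A_\pi$ are the solutions $x\in\mathcal I_n$ of $A_\pi(x)=x$. Cycles of length $1$ are included in the decomposition (for $k_j=1$ the product is $a_{i_{j1}i_{j1}}$); cycle notation means $\pi(i_{js})=i_{j,s+1}$ for $s<k_j$ and $\pi(i_{jk_j})=i_{j1}$.
   Formalization: (1) is proved for fixed points without coordinate -∞, and in all of I_n if q=1 (else (0,-∞) is fixed by diag(2,2)); in (2), p is the exact number of products equal to 1, "infinitely many" excludes p=q=1 (only 0 is fixed), and free coordinates are counted as a maximum over finitely many families. *)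

theory Defs
  imports "HOL-Analysis.Analysis"
begin

text \<open>
  The semifield \<open>\<real> \<union> {-\<infinity>}\<close> is represented by the elements of \<^typ>\<open>ereal\<close> other than \<open>\<infinity>\<close>.
\<close>

definition idem_simplex :: "(ereal ^ 'n) set" where
  "idem_simplex = {x. (\<forall>i. x $ i \<noteq> \<infinity>) \<and> Max (range (\<lambda>i. x $ i)) = 0}"

text \<open>
  The library product \<open>*v\<close> needs a semiring, which \<^typ>\<open>ereal\<close> is not. In \<^typ>\<open>ereal\<close>,
  \<open>0 * (-\<infinity>) = 0\<close> and \<open>a * (-\<infinity>) = -\<infinity>\<close> for real \<open>a > 0\<close>, so that zero entries of the
  matrix never contribute (see \<open>mat_act_nth\<close>).
\<close>

definition mat_act :: "real ^ 'n ^ 'n \<Rightarrow> ereal ^ 'n \<Rightarrow> ereal ^ 'n" where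
  "mat_act A x = (\<chi> i. \<Sum>j\<in>UNIV. ereal (A $ i $ j) * x $ j)"

lemma mat_act_nth:
  fixes A :: "real ^ 'n ^ 'n"
  assumes "\<And>j. j \<noteq> \<pi> i \<Longrightarrow> A $ i $ j = 0"
  shows "mat_act A x $ i = ereal (A $ i $ \<pi> i) * x $ \<pi> i"
proof -
  have "(\<Sum>j\<in>UNIV. ereal (A $ i $ j) * x $ j) = (\<Sum>j\<in>{\<pi> i}. ereal (A $ i $ j) * x $ j)"
    by (rule sum.mono_neutral_right) (use assms in \<open>auto simp: zero_ereal_def[symmetric]\<close>)
  then show ?thesis
    by (simp add: mat_act_def)
qed

definition fixed_points :: "real ^ 'n ^ 'n \<Rightarrow> (ereal ^ 'n) set" where
  "fixed_points A = {x \<in> idem_simplex. mat_act A x = x}"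

definition real_fixed_points :: "real ^ 'n ^ 'n \<Rightarrow> (ereal ^ 'n) set" where
  "real_fixed_points A = {x \<in> fixed_points A. \<forall>i. x $ i \<noteq> -\<infinity>}"

text \<open>Cycles of length 1 are listed, so the cycles together exhaust the index set.\<close>

definition cycle_decomposition :: "('n \<Rightarrow> 'n) \<Rightarrow> 'n list list \<Rightarrow> bool" where
  "cycle_decomposition \<pi> cs \<longleftrightarrow>
     [] \<notin> set cs \<and> distinct (concat cs) \<and> set (concat cs) = UNIV \<and>
     (\<forall>c\<in>set cs. \<forall>s<length c. \<pi> (c ! s) = c ! (Suc s mod length c))"

definition cycle_product :: "real ^ 'n ^ 'n \<Rightarrow> 'n list \<Rightarrow> real" where
  "cycle_product A c = (\<Prod>s<length c. A $ (c ! s) $ (c ! (Suc s mod length c)))"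

text \<open>
  The coordinates in \<open>F\<close> are free on \<open>S\<close>: they can be prescribed arbitrarily and independently
  in the value set \<open>V\<close>, and they determine all the other coordinates.
\<close>

definition free_coords :: "ereal set \<Rightarrow> 'n set \<Rightarrow> (ereal ^ 'n) set \<Rightarrow> bool" where
  "free_coords V F S \<longleftrightarrow> bij_betw (\<lambda>x. restrict (\<lambda>i. x $ i) F) S (F \<rightarrow>\<^sub>E V)"

text \<open>
  A solution set with \<open>m\<close> free coordinates. Several families of solutions are needed in general:
  if all cycle products are 1, the condition that the maximum is 0 forces one of the cycles to
  vanish, but any cycle can be that one; each choice leaves the other cycles free. Families with
  fewer free coordinates are admitted because coordinates \<open>-\<infinity>\<close> on all cycles of product
  different from 1 likewise force one of the remaining cycles to vanish.
\<close>

definition has_free_coords :: "ereal set \<Rightarrow> nat \<Rightarrow> (ereal ^ 'n) set \<Rightarrow> bool" where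
  "has_free_coords V m S \<longleftrightarrow>
     (\<exists>\<P>. finite \<P> \<and> \<Union>\<P> = S \<and>
        (\<forall>P\<in>\<P>. \<exists>F. card F \<le> m \<and> free_coords V F P) \<and>
        (\<exists>P\<in>\<P>. \<exists>F. card F = m \<and> free_coords V F P))"

end

theory Submission
  imports Defs
begin

text \<open>
  The equation \<open>A\<^sub>\<pi>(x) = x\<close> links coordinates only within a cycle of \<open>\<pi>\<close>: going round a cycle,
  every coordinate is a positive multiple of the one at the head of the cycle, and the head \<open>y\<close> has
  to satisfy \<open>y = P * y\<close> with \<open>P\<close> the cycle product. For \<open>y \<le> 0\<close> this means that \<open>y\<close> is arbitrary
  if \<open>P = 1\<close>, and \<open>y \<in> {0, -\<infinity>}\<close> otherwise. The maximum is \<open>0\<close> iff some head vanishes. So the fixed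
  points are parametrized by the heads of the cycles with product 1, after a choice either of the
  nonempty set of vanishing heads among the other cycles, or, if all of those heads are \<open>-\<infinity>\<close>, of
  one vanishing head among the cycles with product 1.
\<close>

section \<open>Scalar equations in \<open>ereal\<close> and equations around a cycle\<close>

lemma ereal_inverse_mult_cancel:
  fixes r :: real and y :: ereal
  assumes "r > 0"
  shows "ereal (1 / r) * (ereal r * y) = y"
proof -
  have "ereal (1 / r) * (ereal r * y) = ereal (1 / r * r) * y"
    by (metis mult.assoc times_ereal.simps(1))
  then show ?thesis
    using assms by (simp add: one_ereal_def[symmetric])
qed

text \<open>For real \<open>y\<close> this is \<open>(r - 1) * y = 0\<close>, and
  \<open>-\<infinity>\<close> is fixed by every positive factor. So is \<open>\<infinity>\<close>,
  which the sign hypothesis excludes.\<close>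

lemma ereal_eq_mult_self_iff:
  fixes r :: real and y :: ereal
  assumes "r > 0" "y \<le> 0"
  shows "y = ereal r * y \<longleftrightarrow> r = 1 \<or> y = 0 \<or> y = -\<infinity>"
  using assms by (cases y) (auto simp: zero_ereal_def one_ereal_def)

text \<open>Substituting the equations into one another from index 0 gives \<open>f 0\<close> as a
  partial product times \<open>f s\<close>, and the positive factor can be inverted. Going once
  round returns to index 0 and leaves the closing condition.\<close>

lemma cyclic_scaling_iff:
  fixes f :: "nat \<Rightarrow> ereal" and b :: "nat \<Rightarrow> real"
  assumes k: "0 < k" and b: "\<And>s. s < k \<Longrightarrow> 0 < b s"
  shows "(\<forall>s<k. f s = ereal (b s) * f (Suc s mod k)) \<longleftrightarrow>
         (\<forall>s<k. f s = ereal (1 / (\<Prod>t<s. b t)) * f 0) \<and> f 0 = ereal (\<Prod>t<k. b t) * f 0"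
    (is "?L \<longleftrightarrow> ?R")
proof
  have pos: "0 < (\<Prod>t<s. b t)" if "s \<le> k" for s
    using that b by (intro prod_pos) auto
  show ?R if L: ?L
  proof -
    \<comment> \<open>The bound \<open>s \<le> k\<close> and the index \<open>s mod k\<close> let
      one induction yield the values for \<open>s < k\<close> and, at \<open>s = k\<close>, the
      closing condition.\<close>
    have step: "f 0 = ereal (\<Prod>t<s. b t) * f (s mod k)" if "s \<le> k" for s
      using that
    proof (induction s)
      case (Suc s)
      then have "f (s mod k) = ereal (b s) * f (Suc s mod k)"
        using L[rule_format, of s] by simp
      with Suc have "f 0 = ereal (\<Prod>t<s. b t) * (ereal (b s) * f (Suc s mod k))"
        by (metis Suc_leD)
      then show ?case
        by (metis mult.assoc prod.lessThan_Suc times_ereal.simps(1))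
    qed (simp add: one_ereal_def[symmetric])
    have "f s = ereal (1 / (\<Prod>t<s. b t)) * f 0" if "s < k" for s
      using step[of s] ereal_inverse_mult_cancel[OF pos, of s "f s"] that
      by (metis less_imp_le mod_less)
    moreover have "f 0 = ereal (\<Prod>t<k. b t) * f 0"
      using step[of k] by simp
    ultimately show ?thesis
      by blast
  qed
  show ?L if R: ?R
  proof (intro allI impI)
    fix s assume s: "s < k"
    have f_s: "f s = ereal (1 / (\<Prod>t<s. b t)) * f 0"
      using R s by blast
    \<comment> \<open>Only the last index wraps around to 0 and uses the closing condition;
      elsewhere the ratio of consecutive partial products is \<open>b s\<close>.\<close>
    show "f s = ereal (b s) * f (Suc s mod k)"
    proof (cases "Suc s = k")
      case True
      have "f 0 = ereal (\<Prod>t<s. b t) * (ereal (b s) * f 0)"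
        using R True by (metis mult.assoc prod.lessThan_Suc times_ereal.simps(1))
      then have "f s = ereal (b s) * f 0"
        using f_s ereal_inverse_mult_cancel[OF pos, of s "ereal (b s) * f 0"] s
        by (metis less_imp_le)
      with True show ?thesis
        by simp
    next
      case False
      with s have "Suc s < k" "Suc s mod k = Suc s"
        by simp_all
      with R have "f (Suc s mod k) = ereal (1 / (\<Prod>t<Suc s. b t)) * f 0"
        by metis
      moreover have "b s * (1 / (\<Prod>t<Suc s. b t)) = 1 / (\<Prod>t<s. b t)"
        using b[OF s] by simp
      ultimately show ?thesis
        using f_s by (metis mult.assoc times_ereal.simps(1))
    qed
  qed
qed

section \<open>The maximum condition and infinite solution sets\<close>

lemma idem_simplex_iff: "x \<in> idem_simplex \<longleftrightarrow> (\<forall>i. x $ i \<le> 0) \<and> (\<exists>i. x $ i = 0)"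
proof -
  have "Max (range (\<lambda>i. x $ i)) = 0 \<longleftrightarrow> (\<forall>i. x $ i \<le> 0) \<and> (\<exists>i. x $ i = 0)"
    by (subst Max_eq_iff) auto
  moreover have "x $ i \<noteq> \<infinity>" if "x $ i \<le> 0" for i
    using that by auto
  ultimately show ?thesis
    unfolding idem_simplex_def by blast
qed

text \<open>\<open>S\<close> corresponds to the functions from \<open>F\<close> to \<open>V\<close>,
  and a single argument already takes infinitely many values.\<close>

lemma infinite_free_coords:
  assumes "free_coords V F S" "infinite V" "F \<noteq> {}"
  shows "infinite S"
proof -
  have "infinite (F \<rightarrow>\<^sub>E V)"
    using assms(2,3) by (subst finite_PiE_iff) (auto simp: PiE_eq_empty_iff)
  with assms(1) show ?thesis
    unfolding free_coords_def using bij_betw_finite by blast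
qed

lemma infinite_has_free_coords:
  assumes "has_free_coords V m S" "infinite V" "0 < m"
  shows "infinite S"
proof -
  obtain \<P> P F where "\<Union>\<P> = S" "P \<in> \<P>" "card F = m" "free_coords V F P"
    using assms(1) unfolding has_free_coords_def by blast
  moreover from this have "infinite P"
    using assms(2,3) by (intro infinite_free_coords[of V F]) auto
  ultimately show ?thesis
    by (meson Union_upper infinite_super)
qed

lemma infinite_nonpos_ereal: "infinite {-\<infinity><..(0::ereal)}"
proof
  assume "finite {-\<infinity><..(0::ereal)}"
  moreover have "ereal ` {..0} \<subseteq> {-\<infinity><..(0::ereal)}"
    by (auto simp: zero_ereal_def)
  ultimately have "finite (ereal ` {..0})"
    by (rule finite_subset[rotated])
  then show False
    by (simp add: finite_image_iff infinite_Iic)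
qed

section \<open>Vectors determined by their values at heads\<close>

text \<open>\<open>h i\<close> stands for the head of the cycle through \<open>i\<close>, and
  \<open>u i\<close> for the factor from the coordinate at the head to the one at \<open>i\<close>.
  Idempotence makes \<open>range h\<close> the set of heads.\<close>

locale head_scaling =
  fixes h :: "'n::finite \<Rightarrow> 'n" and u :: "'n \<Rightarrow> real"
  assumes head_head [simp]: "h (h i) = h i"
    and scale_head [simp]: "u (h i) = 1"
    and scale_pos: "u i > 0"
begin

definition scaled :: "(ereal ^ 'n) set" where
  "scaled = {x. \<forall>i. x $ i = ereal (u i) * x $ h i}"

text \<open>A building block for the families in \<open>has_free_coords\<close>: the heads in
  \<open>F\<close> are parameters, the other heads are pinned by \<open>y\<close>.\<close>

definition slice :: "'n set \<Rightarrow> ereal set \<Rightarrow> ('n \<Rightarrow> ereal) \<Rightarrow> (ereal ^ 'n) set" where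
  "slice F V y = {x \<in> scaled. (\<forall>i\<in>F. x $ i \<in> V) \<and> (\<forall>i\<in>range h - F. x $ i = y i)}"

lemma
  assumes "i \<in> range h"
  shows head_fix: "h i = i" and scale_fix: "u i = 1"
  using assms by auto

lemma free_coords_slice:
  assumes F: "F \<subseteq> range h"
  shows "free_coords V F (slice F V y)"
  unfolding free_coords_def
\<comment> \<open>The inverse extends prescribed head values by scaling. It gives back
  \<open>g\<close> on \<open>F\<close> because \<open>u\<close> is 1 and \<open>h\<close> is the
  identity on heads.\<close>
proof (rule bij_betw_byWitness[where f' =
      "\<lambda>g. \<chi> i. ereal (u i) * (if h i \<in> F then g (h i) else y (h i))"], goal_cases)
  case 1
  show ?case
  proof
    fix x assume x: "x \<in> slice F V y"
    have "ereal (u i) * (if h i \<in> F then x $ h i else y (h i)) = x $ i" for i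
    proof -
      have "x $ h i = y (h i)" if "h i \<notin> F"
        using x that by (auto simp: slice_def)
      moreover have "x $ i = ereal (u i) * x $ h i"
        using x unfolding slice_def scaled_def by blast
      ultimately show ?thesis
        by simp
    qed
    then show "(\<chi> i. ereal (u i) * (if h i \<in> F then restrict (\<lambda>i. x $ i) F (h i) else y (h i))) = x"
      by (simp add: vec_eq_iff cong: if_cong)
  qed
next
  case 2
  show ?case
  proof (intro ballI ext)
    fix g i assume g: "g \<in> F \<rightarrow>\<^sub>E V"
    have "u i = 1" "h i = i" if "i \<in> F"
      using F that by (auto intro: head_fix scale_fix)
    then show "restrict (\<lambda>i. (\<chi> i. ereal (u i) * (if h i \<in> F then g (h i) else y (h i))) $ i) F i
        = g i"
      using PiE_arb[OF g] by (cases "i \<in> F") (simp_all add: one_ereal_def[symmetric])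
  qed
next
  case 3
  then show ?case
    by (auto simp: slice_def)
next
  case 4
  show ?case
  proof clarify
    fix g assume g: "g \<in> F \<rightarrow>\<^sub>E V"
    have "u i = 1" "h i = i" if "i \<in> F" for i
      using F that by (auto intro: head_fix scale_fix)
    then show "(\<chi> i. ereal (u i) * (if h i \<in> F then g (h i) else y (h i))) \<in> slice F V y"
      using g by (auto simp: slice_def scaled_def one_ereal_def[symmetric] PiE_def Pi_def)
  qed
qed

text \<open>A positive real factor preserves the sign, zero and \<open>-\<infinity>\<close>, so
  conditions on all coordinates can be tested at the heads.\<close>

lemma scaled_sign:
  assumes "x \<in> scaled"
  shows "x $ i \<le> 0 \<longleftrightarrow> x $ h i \<le> 0"
    and "x $ i = 0 \<longleftrightarrow> x $ h i = 0"
    and "x $ i = -\<infinity> \<longleftrightarrow> x $ h i = -\<infinity>"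
proof -
  have "x $ i = ereal (u i) * x $ h i"
    using assms unfolding scaled_def by blast
  then show "x $ i \<le> 0 \<longleftrightarrow> x $ h i \<le> 0" "x $ i = 0 \<longleftrightarrow> x $ h i = 0"
      "x $ i = -\<infinity> \<longleftrightarrow> x $ h i = -\<infinity>"
    using scale_pos[of i]
    by (cases "x $ h i"; auto simp: zero_ereal_def mult_le_0_iff)+
qed

lemma zero_scaled: "0 \<in> scaled"
  by (simp add: scaled_def)

lemma scaled_eq_zeroI:
  assumes "x \<in> scaled" "\<And>i. i \<in> range h \<Longrightarrow> x $ i = 0"
  shows "x = 0"
  unfolding vec_eq_iff using assms(2) scaled_sign(2)[OF assms(1)] by (metis rangeI zero_index)

end

section \<open>Fixed points described by their heads\<close>

text \<open>\<open>G\<close> is meant for the heads of cycles with product 1 and \<open>B\<close>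
  for the others. \<open>fixed_iff\<close> stands in for the matrix, so that only head values matter
  from here on.\<close>

locale fixed_point_heads = head_scaling h u
  for h :: "'n::finite \<Rightarrow> 'n" and u :: "'n \<Rightarrow> real" +
  fixes A :: "real ^ 'n ^ 'n" and G B :: "'n set"
  assumes heads: "range h = G \<union> B" "G \<inter> B = {}"
    and fixed_iff: "x \<in> fixed_points A \<longleftrightarrow>
      x \<in> scaled \<and> (\<forall>i\<in>G. x $ i \<le> 0) \<and> (\<forall>i\<in>B. x $ i = 0 \<or> x $ i = -\<infinity>) \<and>
      (\<exists>i\<in>G \<union> B. x $ i = 0)"
begin

text \<open>A coordinate is \<open>-\<infinity>\<close> exactly if its head is, so finiteness only
  restricts the heads and leaves the value 0 on \<open>B\<close>.\<close>

lemma real_fixed_iff: "x \<in> real_fixed_points A \<longleftrightarrow>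
    x \<in> scaled \<and> (\<forall>i\<in>G. x $ i \<in> {-\<infinity><..0}) \<and> (\<forall>i\<in>B. x $ i = 0) \<and> (\<exists>i\<in>G \<union> B. x $ i = 0)"
proof -
  have "(\<forall>i. x $ i \<noteq> -\<infinity>) \<longleftrightarrow> (\<forall>i\<in>G \<union> B. x $ i \<noteq> -\<infinity>)" if "x \<in> scaled"
    using scaled_sign(3)[OF that] unfolding heads(1)[symmetric] by blast
  then show ?thesis
    unfolding real_fixed_points_def by (auto simp: fixed_iff)
qed

lemma complement_heads:
  shows "range h - G = B" and "j \<in> G \<Longrightarrow> range h - (G - {j}) = insert j B"
  using heads by blast+

text \<open>A vanishing head in \<open>B\<close> already meets the maximum condition, so the heads
  in \<open>G\<close> vary independently.\<close>

lemma real_fixed_points_eq_slice: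
  assumes "B \<noteq> {}"
  shows "real_fixed_points A = slice G {-\<infinity><..0} (\<lambda>_. 0)"
  using assms unfolding slice_def complement_heads by (auto simp: real_fixed_iff bex_Un)

text \<open>Some head \<open>j\<close> in \<open>G\<close> has to supply the maximum 0; any of them
  can, whence a union of families with one parameter fewer.\<close>

lemma real_fixed_points_eq_Union:
  assumes "B = {}"
  shows "real_fixed_points A = (\<Union>j\<in>G. slice (G - {j}) {-\<infinity><..0} (\<lambda>_. 0))"
proof -
  have "x \<in> slice (G - {j}) {-\<infinity><..0} (\<lambda>_. 0) \<longleftrightarrow>
      x \<in> scaled \<and> (\<forall>i\<in>G. x $ i \<in> {-\<infinity><..0}) \<and> x $ j = 0" if "j \<in> G" for x j
    using that assms unfolding slice_def complement_heads(2)[OF that] by auto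
  then show ?thesis
    using assms by (auto simp: real_fixed_iff)
qed

text \<open>\<open>T\<close> is the set of vanishing heads in \<open>B\<close>. If it is nonempty,
  the maximum condition holds and all of \<open>G\<close> is free; if it is empty, \<open>B\<close>
  carries \<open>-\<infinity>\<close> and some \<open>j\<close> in \<open>G\<close> has to
  vanish.\<close>

lemma fixed_points_eq_Union:
  "fixed_points A =
     (\<Union>T\<in>Pow B - {{}}. slice G {..0} (\<lambda>i. if i \<in> T then 0 else -\<infinity>)) \<union>
     (\<Union>j\<in>G. slice (G - {j}) {..0} (\<lambda>i. if i = j then 0 else -\<infinity>))"
    (is "_ = (\<Union>T\<in>_. ?P T) \<union> (\<Union>j\<in>_. ?Q j)")
proof -
  have P: "x \<in> ?P T \<longleftrightarrow>
      x \<in> scaled \<and> (\<forall>i\<in>G. x $ i \<le> 0) \<and> (\<forall>i\<in>B. x $ i = (if i \<in> T then 0 else -\<infinity>))" for x T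
    unfolding slice_def complement_heads by auto
  \<comment> \<open>Since \<open>j\<close> lies outside \<open>B\<close>, the pinned value is
    \<open>-\<infinity>\<close> on all of \<open>B\<close>.\<close>
  have Q: "x \<in> ?Q j \<longleftrightarrow>
      x \<in> scaled \<and> (\<forall>i\<in>G. x $ i \<le> 0) \<and> (\<forall>i\<in>B. x $ i = -\<infinity>) \<and> x $ j = 0" if "j \<in> G" for x j
    using that heads(2) unfolding slice_def complement_heads(2)[OF that] by auto
  show ?thesis
  proof (intro equalityI subsetI)
    fix x assume x: "x \<in> fixed_points A"
    let ?T = "{i \<in> B. x $ i = 0}"
    show "x \<in> (\<Union>T\<in>Pow B - {{}}. ?P T) \<union> (\<Union>j\<in>G. ?Q j)"
    proof (cases "?T = {}")
      case True
      then obtain j where "j \<in> G" "x $ j = 0"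
        using x by (auto simp: fixed_iff)
      then have "x \<in> ?Q j"
        using x True by (auto simp: Q fixed_iff)
      with \<open>j \<in> G\<close> show ?thesis
        by blast
    next
      case False
      have *: "x \<in> ?P ?T"
        unfolding P using x by (auto simp: fixed_iff)
      have "?T \<in> Pow B - {{}}"
        using False by blast
      from UN_I[of ?T _ x ?P, OF this *] show ?thesis
        by (rule UnI1)
    qed
  next
    fix x assume "x \<in> (\<Union>T\<in>Pow B - {{}}. ?P T) \<union> (\<Union>j\<in>G. ?Q j)"
    then consider T where "T \<subseteq> B" "T \<noteq> {}" "x \<in> ?P T" | j where "j \<in> G" "x \<in> ?Q j"
      by blast
    then show "x \<in> fixed_points A"
    proof cases
      case 1
      then obtain i where "i \<in> T" "i \<in> B"
        by blast
      with 1 show ?thesis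
        by (auto simp: P fixed_iff)
    next
      case 2
      then show ?thesis
        by (auto simp: Q fixed_iff)
    qed
  qed
qed

lemma real_fixed_points_trivial:
  assumes "G = {}"
  shows "real_fixed_points A = {0}"
proof -
  have "B \<noteq> {}"
    using heads assms by blast
  then have "0 \<in> real_fixed_points A"
    using assms by (auto simp: real_fixed_iff zero_scaled)
  moreover have "x = 0" if "x \<in> real_fixed_points A" for x
    using that assms heads by (intro scaled_eq_zeroI) (auto simp: real_fixed_iff)
  ultimately show ?thesis
    by blast
qed

text \<open>A head in \<open>B\<close> may also be \<open>-\<infinity>\<close>, but the maximum
  condition forbids this for the only head.\<close>

lemma fixed_points_trivial:
  assumes "G = {}" "card B = 1"
  shows "fixed_points A = {0}"
proof -
  obtain b where b: "B = {b}"
    using assms(2) card_1_singletonE by blast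
  have "0 \<in> fixed_points A"
    using assms b by (auto simp: fixed_iff zero_scaled)
  moreover have "x = 0" if "x \<in> fixed_points A" for x
    using that assms(1) b heads by (intro scaled_eq_zeroI) (auto simp: fixed_iff)
  ultimately show ?thesis
    by blast
qed

lemma free_coords_real_fixed_points:
  assumes "B \<noteq> {}"
  shows "free_coords {-\<infinity><..0} G (real_fixed_points A)"
  unfolding real_fixed_points_eq_slice[OF assms] using heads by (intro free_coords_slice) auto

lemma has_free_coords_real_fixed_points:
  assumes "B = {}"
  shows "has_free_coords {-\<infinity><..0} (card G - 1) (real_fixed_points A)"
proof -
  let ?R = "\<lambda>j. slice (G - {j}) {-\<infinity><..0} (\<lambda>_. 0)"
  have "free_coords {-\<infinity><..0} (G - {j}) (?R j)" for j
    using heads by (intro free_coords_slice) auto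
  moreover have "card (G - {j}) = card G - 1" if "j \<in> G" for j
    using that by simp
  ultimately have "\<exists>F. card F = card G - 1 \<and> free_coords {-\<infinity><..0} F (?R j)" if "j \<in> G" for j
    using that by blast
  \<comment> \<open>Some family has to attain the count; a head in \<open>G\<close> provides
    it.\<close>
  moreover have "G \<noteq> {}"
    using heads assms by blast
  ultimately show ?thesis
    unfolding has_free_coords_def real_fixed_points_eq_Union[OF assms]
    by (intro exI[of _ "?R ` G"]) (simp add: ex_in_conv[symmetric], metis order_refl)
qed

text \<open>The families \<open>?P T\<close> have \<open>card G\<close> parameters and occur only
  for nonempty \<open>B\<close>, where \<open>?P B\<close> attains the count. The families
  \<open>?Q j\<close> have one parameter fewer and are all there is for empty
  \<open>B\<close>.\<close>

lemma has_free_coords_fixed_points: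
  "has_free_coords {..0} (if B = {} then card G - 1 else card G) (fixed_points A)"
proof -
  let ?m = "if B = {} then card G - 1 else card G"
  let ?P = "\<lambda>T. slice G {..0} (\<lambda>i. if i \<in> T then 0 else -\<infinity>)"
  let ?Q = "\<lambda>j. slice (G - {j}) {..0} (\<lambda>i. if i = j then 0 else -\<infinity>)"
  let ?\<P> = "?P ` (Pow B - {{}}) \<union> ?Q ` G"
  have P: "free_coords {..0} G (?P T)" for T
    using heads by (intro free_coords_slice) auto
  have Q: "free_coords {..0} (G - {j}) (?Q j)" for j
    using heads by (intro free_coords_slice) auto
  have "\<exists>F. card F \<le> ?m \<and> free_coords {..0} F X" if "X \<in> ?\<P>" for X
  proof -
    consider T where "B \<noteq> {}" "X = ?P T" | j where "j \<in> G" "X = ?Q j"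
      using \<open>X \<in> ?\<P>\<close> by blast
    then show ?thesis
    proof cases
      case 1
      then show ?thesis
        using P by (intro exI[of _ G]) auto
    next
      case 2
      then show ?thesis
        using Q by (intro exI[of _ "G - {j}"]) auto
    qed
  qed
  moreover have "\<exists>X\<in>?\<P>. \<exists>F. card F = ?m \<and> free_coords {..0} F X"
  proof (cases "B = {}")
    case True
    then obtain j where "j \<in> G"
      using heads by blast
    then show ?thesis
      using Q True by (intro bexI[of _ "?Q j"] exI[of _ "G - {j}"]) auto
  next
    case False
    then show ?thesis
      using P by (intro bexI[of _ "?P B"] exI[of _ G]) auto
  qed
  ultimately show ?thesis
    unfolding has_free_coords_def fixed_points_eq_Union
    by (intro exI[of _ ?\<P>]) auto
qed

text \<open>If \<open>B\<close> is empty, one head is pinned and \<open>card G \<ge> 2\<close>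
  leaves another one free; otherwise all of the nonempty \<open>G\<close> is free.\<close>

lemma infinite_real_fixed_points:
  assumes "0 < card G" "card G + card B \<noteq> 1"
  shows "infinite (real_fixed_points A)"
proof (cases "B = {}")
  case True
  then have "0 < card G - 1"
    using assms by simp
  with True show ?thesis
    using has_free_coords_real_fixed_points infinite_has_free_coords
      infinite_nonpos_ereal by blast
next
  case False
  moreover have "G \<noteq> {}"
    using assms(1) by auto
  ultimately show ?thesis
    using free_coords_real_fixed_points infinite_free_coords infinite_nonpos_ereal by blast
qed

end

section \<open>Heads and scaling factors from the cycle decomposition\<close>

context
  fixes A :: "real ^ 'n ^ 'n" and \<pi> :: "'n \<Rightarrow> 'n" and cs :: "'n list list"
  assumes pos: "A $ i $ \<pi> i > 0"
    and zero: "j \<noteq> \<pi> i \<Longrightarrow> A $ i $ j = 0"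
    and cycles: "cycle_decomposition \<pi> cs"
begin

lemma cycle_ne: "c \<in> set cs \<Longrightarrow> c \<noteq> []"
  using cycles by (auto simp: cycle_decomposition_def)

lemma cycle_next: "c \<in> set cs \<Longrightarrow> s < length c \<Longrightarrow> \<pi> (c ! s) = c ! (Suc s mod length c)"
  using cycles by (auto simp: cycle_decomposition_def)

lemma cycle_entry_pos:
  "c \<in> set cs \<Longrightarrow> s < length c \<Longrightarrow> A $ (c ! s) $ (c ! (Suc s mod length c)) > 0"
  using pos[of "c ! s"] cycle_next by simp

lemma cycle_product_pos: "c \<in> set cs \<Longrightarrow> cycle_product A c > 0"
  unfolding cycle_product_def by (intro prod_pos ballI cycle_entry_pos) auto

lemma cycle_unique:
  assumes "c \<in> set cs" "d \<in> set cs" "i \<in> set c" "i \<in> set d"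
  shows "c = d"
  using assms cycles by (auto simp: cycle_decomposition_def distinct_concat_iff)

lemma distinct_cycles: "distinct cs"
  using cycles by (auto simp: cycle_decomposition_def distinct_concat_iff)

lemma inj_on_hd_cycles: "inj_on hd (set cs)"
proof (rule inj_onI)
  fix c d assume "c \<in> set cs" "d \<in> set cs" "hd c = hd d"
  moreover from this have "hd c \<in> set c" "hd c \<in> set d"
    using hd_in_set[of c] hd_in_set[of d] cycle_ne by simp_all
  ultimately show "c = d"
    using cycle_unique by blast
qed

text \<open>Row \<open>i\<close> has its only nonzero entry at \<open>\<pi> i\<close>, and every
  index occurs at some position of a listed cycle.\<close>

lemma mat_act_fixed_iff:
  "mat_act A x = x \<longleftrightarrow>
     (\<forall>c\<in>set cs. \<forall>s<length c.
        x $ (c ! s) = ereal (A $ (c ! s) $ (c ! (Suc s mod length c))) * x $ (c ! (Suc s mod length c)))"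
proof -
  have act: "mat_act A x $ i = ereal (A $ i $ \<pi> i) * x $ \<pi> i" for i
    by (rule mat_act_nth) (rule zero)
  have in_cycle: "\<exists>c\<in>set cs. i \<in> set c" for i
    using cycles by (auto simp: cycle_decomposition_def)
  have "mat_act A x = x \<longleftrightarrow> (\<forall>i. x $ i = ereal (A $ i $ \<pi> i) * x $ \<pi> i)"
    unfolding vec_eq_iff act by (rule all_cong1) (rule eq_commute)
  also have "\<dots> \<longleftrightarrow> (\<forall>c\<in>set cs. \<forall>i\<in>set c. x $ i = ereal (A $ i $ \<pi> i) * x $ \<pi> i)"
    using in_cycle by blast
  also have "\<dots> \<longleftrightarrow> (\<forall>c\<in>set cs. \<forall>s<length c.
      x $ (c ! s) = ereal (A $ (c ! s) $ \<pi> (c ! s)) * x $ \<pi> (c ! s))"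
    by (simp add: all_set_conv_all_nth)
  finally show ?thesis
    by (simp add: cycle_next)
qed

text \<open>\<open>cyclic_scaling_iff\<close> on each cycle, with the first list entry as head,
  turns the equation into scaling from the heads and one closing condition per cycle.\<close>

lemma cycle_head_scaling:
  obtains h u where "head_scaling h u" "range h = hd ` set cs"
    "\<And>x. mat_act A x = x \<longleftrightarrow> x \<in> head_scaling.scaled h u \<and>
       (\<forall>c\<in>set cs. x $ hd c = ereal (cycle_product A c) * x $ hd c)"
proof -
  \<comment> \<open>The factor from the head to position \<open>s\<close>; the empty product makes
    it 1 at the head.\<close>
  define w where
    "w c s = 1 / (\<Prod>t<s. A $ (c ! t) $ (c ! (Suc t mod length c)))" for c :: "'n list" and s
  have "\<exists>c s. c \<in> set cs \<and> s < length c \<and> c ! s = i" for i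
    using cycles unfolding cycle_decomposition_def
    by (metis UNIV_I in_set_conv_nth set_concat UN_E)
  then obtain C p where C: "C i \<in> set cs" and p: "p i < length (C i)" "C i ! p i = i" for i
    by metis
  \<comment> \<open>Disjointness of the cycles and distinctness of their entries make the chosen
    cycle and position of an index the only ones.\<close>
  have C_nth: "C (c ! s) = c" if "c \<in> set cs" "s < length c" for c s
    using that C p by (metis cycle_unique nth_mem)
  have p_nth: "p (c ! s) = s" if "c \<in> set cs" "s < length c" for c s
    using that p[of "c ! s"] C_nth[OF that] cycles
    by (metis cycle_decomposition_def distinct_concat_iff nth_eq_iff_index_eq)
  have hd: "c ! 0 = hd c" "0 < length c" if "c \<in> set cs" for c
    using cycle_ne[OF that] by (simp_all add: hd_conv_nth)
  have C_hd: "C (hd c) = c" "p (hd c) = 0" if "c \<in> set cs" for c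
    using C_nth[of c 0] p_nth[of c 0] hd[OF that] that by simp_all
  let ?h = "\<lambda>i. hd (C i)" and ?u = "\<lambda>i. w (C i) (p i)"
  have w_pos: "w c s > 0" if "c \<in> set cs" "s < length c" for c s
    unfolding w_def using that by (intro divide_pos_pos prod_pos ballI cycle_entry_pos) auto
  have w_0: "w c 0 = 1" for c
    by (simp add: w_def)
  interpret head_scaling ?h ?u
    by unfold_locales (use C p C_hd w_pos w_0 in simp_all)
  have range: "range ?h = hd ` set cs"
    using C C_hd by (auto simp: image_iff) (metis)
  have "mat_act A x = x \<longleftrightarrow> x \<in> scaled \<and>
       (\<forall>c\<in>set cs. x $ hd c = ereal (cycle_product A c) * x $ hd c)" for x
  proof -
    have cycle: "(\<forall>s<length c. x $ (c ! s) =
          ereal (A $ (c ! s) $ (c ! (Suc s mod length c))) * x $ (c ! (Suc s mod length c))) \<longleftrightarrow>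
        (\<forall>s<length c. x $ (c ! s) = ereal (w c s) * x $ hd c) \<and>
        x $ hd c = ereal (cycle_product A c) * x $ hd c" if "c \<in> set cs" for c
      using cyclic_scaling_iff[of "length c" "\<lambda>s. A $ (c ! s) $ (c ! (Suc s mod length c))"
          "\<lambda>s. x $ (c ! s)"] hd[OF that] cycle_entry_pos[OF that]
      by (simp add: w_def cycle_product_def)
    have "x \<in> scaled \<longleftrightarrow> (\<forall>c\<in>set cs. \<forall>s<length c. x $ (c ! s) = ereal (w c s) * x $ hd c)"
    proof
      show "\<forall>c\<in>set cs. \<forall>s<length c. x $ (c ! s) = ereal (w c s) * x $ hd c" if "x \<in> scaled"
      proof (intro ballI allI impI)
        fix c s assume "c \<in> set cs" "s < length c"
        then show "x $ (c ! s) = ereal (w c s) * x $ hd c"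
          using that[unfolded scaled_def mem_Collect_eq, rule_format, of "c ! s"]
          by (simp only: C_nth p_nth)
      qed
      show "x \<in> scaled" if "\<forall>c\<in>set cs. \<forall>s<length c. x $ (c ! s) = ereal (w c s) * x $ hd c"
        unfolding scaled_def
      proof (intro CollectI allI)
        fix i
        show "x $ i = ereal (w (C i) (p i)) * x $ hd (C i)"
          using that[rule_format, OF C p(1), of i] by (simp only: p(2))
      qed
    qed
    moreover have "mat_act A x = x \<longleftrightarrow> (\<forall>c\<in>set cs.
        (\<forall>s<length c. x $ (c ! s) = ereal (w c s) * x $ hd c) \<and>
        x $ hd c = ereal (cycle_product A c) * x $ hd c)"
      unfolding mat_act_fixed_iff by (intro ball_cong refl cycle)
    ultimately show ?thesis
      by blast
  qed
  with that[OF head_scaling_axioms range] show thesis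
    by blast
qed

text \<open>\<open>scaled_sign\<close> moves the maximum condition to the heads, and
  \<open>ereal_eq_mult_self_iff\<close> solves the closing condition there.\<close>

lemma cycle_fixed_point_heads:
  obtains h u where "fixed_point_heads h u A
    (hd ` {c \<in> set cs. cycle_product A c = 1}) (hd ` {c \<in> set cs. cycle_product A c \<noteq> 1})"
proof -
  obtain h u where hu: "head_scaling h u" and range: "range h = hd ` set cs"
    and fixed: "\<And>x. mat_act A x = x \<longleftrightarrow> x \<in> head_scaling.scaled h u \<and>
       (\<forall>c\<in>set cs. x $ hd c = ereal (cycle_product A c) * x $ hd c)"
    using cycle_head_scaling by blast
  interpret head_scaling h u
    by (fact hu)
  let ?G = "hd ` {c \<in> set cs. cycle_product A c = 1}"
  let ?B = "hd ` {c \<in> set cs. cycle_product A c \<noteq> 1}"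
  have heads: "range h = ?G \<union> ?B" "?G \<inter> ?B = {}"
    using range inj_on_hd_cycles by (auto dest: inj_onD)
  have "x \<in> fixed_points A \<longleftrightarrow> x \<in> scaled \<and> (\<forall>i\<in>?G. x $ i \<le> 0) \<and>
      (\<forall>i\<in>?B. x $ i = 0 \<or> x $ i = -\<infinity>) \<and> (\<exists>i\<in>?G \<union> ?B. x $ i = 0)" for x
  proof (cases "x \<in> scaled")
    case True
    have "(\<forall>i. x $ i \<le> 0) \<longleftrightarrow> (\<forall>i\<in>range h. x $ i \<le> 0)"
      using scaled_sign(1)[OF True] by blast
    then have le: "(\<forall>i. x $ i \<le> 0) \<longleftrightarrow> (\<forall>c\<in>set cs. x $ hd c \<le> 0)"
      by (simp add: range)
    have eq: "(\<exists>i. x $ i = 0) \<longleftrightarrow> (\<exists>i\<in>?G \<union> ?B. x $ i = 0)"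
      using scaled_sign(2)[OF True] unfolding heads(1)[symmetric] by blast
    have "x $ hd c = ereal (cycle_product A c) * x $ hd c \<longleftrightarrow>
        cycle_product A c = 1 \<or> x $ hd c = 0 \<or> x $ hd c = -\<infinity>"
      if "c \<in> set cs" "x $ hd c \<le> 0" for c
      using that by (intro ereal_eq_mult_self_iff cycle_product_pos)
    \<comment> \<open>The inequality stays next to the equation because the scalar criterion was
      obtained for nonpositive values.\<close>
    then have "(\<forall>c\<in>set cs. x $ hd c \<le> 0 \<and> x $ hd c = ereal (cycle_product A c) * x $ hd c) \<longleftrightarrow>
        (\<forall>i\<in>?G. x $ i \<le> 0) \<and> (\<forall>i\<in>?B. x $ i = 0 \<or> x $ i = -\<infinity>)"
      by fastforce
    moreover have "x \<in> fixed_points A \<longleftrightarrow> (\<forall>i. x $ i \<le> 0) \<and> (\<exists>i. x $ i = 0) \<and>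
        (\<forall>c\<in>set cs. x $ hd c = ereal (cycle_product A c) * x $ hd c)"
      unfolding fixed_points_def using True idem_simplex_iff[of x] fixed[of x] by blast
    ultimately show ?thesis
      using True eq le by blast
  qed (simp add: fixed_points_def fixed)
  with heads have "fixed_point_heads h u A ?G ?B"
    by unfold_locales auto
  then show thesis
    by (rule that)
qed

text \<open>The listed cycles are pairwise different and so are their heads, so counting heads
  amounts to counting positions in \<open>cs\<close>.\<close>

lemma card_cycle_heads:
  "card (hd ` {c \<in> set cs. P c}) = card {j. j < length cs \<and> P (cs ! j)}"
proof -
  have "card (hd ` {c \<in> set cs. P c}) = card {c \<in> set cs. P c}"
    using inj_on_hd_cycles by (intro card_image) (auto intro: inj_on_subset)
  also have "\<dots> = card ((!) cs ` {j. j < length cs \<and> P (cs ! j)})"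
    by (intro arg_cong[where f = card]) (auto simp: in_set_conv_nth)
  also have "\<dots> = card {j. j < length cs \<and> P (cs ! j)}"
    using distinct_cycles by (intro card_image inj_on_nth) auto
  finally show ?thesis .
qed

end

section \<open>Counting the cycles and collecting the cases\<close>

text \<open>Uniqueness concerns finite fixed points unless \<open>q = 1\<close>: with several cycles
  of product other than 1, some heads can be 0 and the others \<open>-\<infinity>\<close>. For
  \<open>p = q = 1\<close> the maximum condition leaves only 0, so infinitude excludes this
  case.\<close>

theorem theorem3p4:
  fixes A :: "real ^ 'n ^ 'n" and \<pi> :: "'n \<Rightarrow> 'n" and cs :: "'n list list" and q :: nat
  assumes "\<pi> permutes UNIV"
    and "\<And>i. A $ i $ \<pi> i > 0"
    and "\<And>i j. j \<noteq> \<pi> i \<Longrightarrow> A $ i $ j = 0"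
    and "cycle_decomposition \<pi> cs"
    and "q = length cs"
  shows "((\<forall>j<q. cycle_product A (cs ! j) \<noteq> 1) \<longrightarrow>
            real_fixed_points A = {0} \<and>
            (q = 1 \<longrightarrow> fixed_points A = {0})) \<and>
         (\<forall>p\<in>{1..q}. card {j. j < q \<and> cycle_product A (cs ! j) = 1} = p \<longrightarrow>
            (\<not> (p = 1 \<and> q = 1) \<longrightarrow>
               infinite (fixed_points A) \<and> infinite (real_fixed_points A)) \<and>
            (p < q \<longrightarrow>
               has_free_coords {..0} p (fixed_points A) \<and>
               (\<exists>F. card F = p \<and> free_coords {-\<infinity><..0} F (real_fixed_points A))) \<and>
            (p = q \<longrightarrow>
               has_free_coords {..0} (q - 1) (fixed_points A) \<and>
               has_free_coords {-\<infinity><..0} (q - 1) (real_fixed_points A)))"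
proof -
  note cycles = assms(2-4)
  let ?G = "hd ` {c \<in> set cs. cycle_product A c = 1}"
  let ?B = "hd ` {c \<in> set cs. cycle_product A c \<noteq> 1}"
  obtain h u where "fixed_point_heads h u A ?G ?B"
    using cycle_fixed_point_heads[OF cycles] by blast
  then interpret fixed_point_heads h u A ?G ?B .
  have G: "card ?G = card {j. j < q \<and> cycle_product A (cs ! j) = 1}"
    unfolding assms(5) by (rule card_cycle_heads[OF cycles])
  have "card ?G + card ?B = card (?G \<union> ?B)"
    using heads(2) by (intro card_Un_disjoint[symmetric]) auto
  also have "?G \<union> ?B = hd ` {c \<in> set cs. True}"
    by auto
  also have "card \<dots> = q"
    using card_cycle_heads[OF cycles, of "\<lambda>_. True"] assms(5) by simp
  finally have GB: "card ?G + card ?B = q" .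
  show ?thesis
  proof (intro conjI ballI impI)
    assume "\<forall>j<q. cycle_product A (cs ! j) \<noteq> 1"
    then have "?G = {}"
      using assms(5) by (auto simp: in_set_conv_nth)
    then show "real_fixed_points A = {0}"
      by (rule real_fixed_points_trivial)
    assume "q = 1"
    then have "card ?B = 1"
      using GB unfolding \<open>?G = {}\<close> by simp
    with \<open>?G = {}\<close> show "fixed_points A = {0}"
      by (rule fixed_points_trivial)
  next
    fix p assume p: "p \<in> {1..q}" "card {j. j < q \<and> cycle_product A (cs ! j) = 1} = p"
    have card_G: "card ?G = p"
      using G p(2) by simp
    show "infinite (real_fixed_points A)" if "\<not> (p = 1 \<and> q = 1)"
    proof (rule infinite_real_fixed_points)
      show "0 < card ?G"
        unfolding card_G using p(1) by simp
      \<comment> \<open>As \<open>p\<close> lies between 1 and \<open>q\<close>, a total of one head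
        would be the excluded case.\<close>
      show "card ?G + card ?B \<noteq> 1"
        unfolding GB using that p(1) by auto
    qed
    then show "infinite (fixed_points A)" if "\<not> (p = 1 \<and> q = 1)"
      using that infinite_super[of "real_fixed_points A" "fixed_points A"]
      by (auto simp: real_fixed_points_def)
    \<comment> \<open>The case split on \<open>B\<close> becomes the comparison of \<open>p\<close>
      with \<open>q\<close>.\<close>
    have "card ?B = 0 \<longleftrightarrow> ?B = {}"
      by (rule card_0_eq) simp
    then have B: "?B = {} \<longleftrightarrow> p = q"
      using GB card_G by linarith
    show "has_free_coords {..0} p (fixed_points A)" if "p < q"
      using has_free_coords_fixed_points that by (simp only: B card_G) simp
    show "\<exists>F. card F = p \<and> free_coords {-\<infinity><..0} F (real_fixed_points A)" if "p < q"
      using free_coords_real_fixed_points that card_G B by blast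
    show "has_free_coords {..0} (q - 1) (fixed_points A)" if "p = q"
      using has_free_coords_fixed_points that by (simp only: B card_G) simp
    show "has_free_coords {-\<infinity><..0} (q - 1) (real_fixed_points A)" if "p = q"
      using has_free_coords_real_fixed_points that by (simp only: B card_G)
  qed
qed

end
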